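(* Let $h$ be a strict CBF of $\mathcal{C}$ and suppose $h(\mathbf{0}_n)>0$. An undesired equilibrium $\mathbf{x}_*\in\hat{\mathcal{E}}$ of the filtered system $\dot{\mathbf{x}}=\tilde f(\mathbf{x})+g(\mathbf{x})v(\mathbf{x})$ is isolated if the Jacobian of $\tilde f+gv$ evaluated at $\mathbf{x}_*$ (assumed to exist) has no eigenvalue with zero real part. Moreover, if $\partial\mathcal{C}$ is bounded, then each undesired equilibrium of the filtered system is isolated if and only if $|\hat{\mathcal{E}}|<\infty$.
   Context: Setting. $f:\mathbb{R}^n\to\mathbb{R}^n$, $g:\mathbb{R}^n\to\mathbb{R}^{n\times m}$ are locally Lipschitz and define $\dot{\mathbf{x}}=f(\mathbf{x})+g(\mathbf{x})\mathbf{u}$. A locally Lipschitz nominal controller $k:\mathbb{R}^n\to\mathbb{R}^m$ is given such that $\dot{\mathbf{x}}=\tilde f(\mathbf{x}):=f(\mathbf{x})+g(\mathbf{x})k(\mathbf{x})$ has the origin as its unique equilibrium, which is globally asymptotically stable. A function $\alpha:\mathbb{R}\to\mathbb{R}$ is of extended class $\mathcal{K}_\infty$ if it is (continuous and) strictly increasing, $\alpha(0)=0$ and $\lim_{s\to\pm\infty}\alpha(s)=\pm\infty$. Let $\mathcal{C}\subset\mathbb{R}^n$ and let $h:\mathbb{R}^n\to\mathbb{R}$ be continuously differentiable with $\mathcal{C}=\{h\ge 0\}$ and $\partial\mathcal{C}=\{h=0\}$. $h$ is a strict control barrier function (strict CBF) of $\mathcal{C}$ with associated $\alpha$ if for every $\mathbf{x}\in\mathcal{C}$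 there is $\mathbf{u}\in\mathbb{R}^m$ with $\nabla h(\mathbf{x})^\top(f(\mathbf{x})+g(\mathbf{x})\mathbf{u})+\alpha(h(\mathbf{x}))>0$. Filtered system: $\dot{\mathbf{x}}=\tilde f(\mathbf{x})+g(\mathbf{x})v(\mathbf{x})$, where the safety filter $v(\mathbf{x})$ is the unique minimizer of $\boldsymbol\theta^\top G(\mathbf{x})\boldsymbol\theta$ over $\boldsymbol\theta\in\mathbb{R}^m$ subject to $\nabla h(\mathbf{x})^\top(\tilde f(\mathbf{x})+g(\mathbf{x})\boldsymbol\theta)+\alpha(h(\mathbf{x}))\ge 0$; $G:\mathbb{R}^n\to\mathbb{R}^{m\times m}$ is continuously differentiable with positive definite values. $v$ is well defined and locally Lipschitz on $\mathcal{C}$ (indeed on an open neighborhood of $\mathcal{C}$), and $\mathcal{C}$ is forward invariant. The set of undesired equilibria is $\hat{\mathcal{E}}=\{\mathbf{x}\in\mathbb{R}^n:\ h(\mathbf{x})=0 \text{ and } \exists\,\delta<0 \text{ with } \tilde f(\mathbf{x})=\delta g(\mathbf{x})G(\mathbf{x})^{-1}g(\mathbf{x})^\top\nabla h(\mathbf{x})\}$; equivalently, the equilibria of the filtered system in $\mathcal{C}$ other than the origin. An equilibrium is isolated if it has an open neighborhood in which it is the only equilibrium. *)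

theory Defs
  imports "HOL-Analysis.Analysis"
begin

section \<open>Regularity\<close>

text \<open>The library notion \<^const>\<open>local_lipschitz\<close> concerns time-dependent maps; here the
  time argument is ignored.\<close>

definition locally_lipschitz :: "('a::metric_space \<Rightarrow> 'b::metric_space) \<Rightarrow> bool" where
  "locally_lipschitz F \<longleftrightarrow> local_lipschitz (UNIV :: real set) UNIV (\<lambda>_. F)"

definition continuously_differentiable ::
    "('a::real_normed_vector \<Rightarrow> 'b::real_normed_vector) \<Rightarrow> bool" where
  "continuously_differentiable F \<longleftrightarrow>
     (\<exists>F' :: 'a \<Rightarrow> 'a \<Rightarrow>\<^sub>L 'b.
        (\<forall>x. (F has_derivative blinfun_apply (F' x)) (at x)) \<and> continuous_on UNIV F')"

definition gradient :: "('a::real_inner \<Rightarrow> real) \<Rightarrow> 'a \<Rightarrow> 'a" where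
  "gradient h x = (THE D. GDERIV h x :> D)"

section \<open>Matrices\<close>

text \<open>Positive definite matrices are symmetric by convention.\<close>

definition positive_definite :: "real ^ 'm ^ 'm \<Rightarrow> bool" where
  "positive_definite A \<longleftrightarrow> transpose A = A \<and> (\<forall>x. x \<noteq> 0 \<longrightarrow> x \<bullet> (A *v x) > 0)"

definition complex_eigenvalue :: "real ^ 'n ^ 'n \<Rightarrow> complex \<Rightarrow> bool" where
  "complex_eigenvalue A z \<longleftrightarrow>
     (\<exists>w :: complex ^ 'n. w \<noteq> 0 \<and> map_matrix complex_of_real A *v w = z *s w)"

section \<open>Autonomous systems\<close>

definition solves_autonomous ::
    "('a::real_normed_vector \<Rightarrow> 'a) \<Rightarrow> (real \<Rightarrow> 'a) \<Rightarrow> bool" where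
  "solves_autonomous F x \<longleftrightarrow>
     (\<forall>t\<ge>0. (x has_vector_derivative F (x t)) (at t within {0..}))"

text \<open>For a locally Lipschitz \<open>F\<close> solutions are unique, so the existence of a solution
  on \<open>[0, \<infinity>)\<close> from every initial state says that all maximal solutions are global.\<close>

definition globally_asymptotically_stable_origin ::
    "('a::real_normed_vector \<Rightarrow> 'a) \<Rightarrow> bool" where
  "globally_asymptotically_stable_origin F \<longleftrightarrow>
     (\<forall>x0. \<exists>x. solves_autonomous F x \<and> x 0 = x0) \<and>
     (\<forall>\<epsilon>>0. \<exists>\<delta>>0. \<forall>x. solves_autonomous F x \<and> norm (x 0) < \<delta> \<longrightarrow> (\<forall>t\<ge>0. norm (x t) < \<epsilon>)) \<and>
     (\<forall>x. solves_autonomous F x \<longrightarrow> (x \<longlongrightarrow> 0) at_top)"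

definition closed_loop ::
    "(real ^ 'n \<Rightarrow> real ^ 'n) \<Rightarrow> (real ^ 'n \<Rightarrow> real ^ 'm ^ 'n) \<Rightarrow> (real ^ 'n \<Rightarrow> real ^ 'm) \<Rightarrow>
     real ^ 'n \<Rightarrow> real ^ 'n" where
  "closed_loop f g k x = f x + g x *v k x"

section \<open>Control barrier functions and safety filters\<close>

definition extended_class_K_inf :: "(real \<Rightarrow> real) \<Rightarrow> bool" where
  "extended_class_K_inf \<alpha> \<longleftrightarrow>
     continuous_on UNIV \<alpha> \<and> strict_mono \<alpha> \<and> \<alpha> 0 = 0 \<and>
     filterlim \<alpha> at_top at_top \<and> filterlim \<alpha> at_bot at_bot"

definition strict_CBF ::
    "(real ^ 'n \<Rightarrow> real ^ 'n) \<Rightarrow> (real ^ 'n \<Rightarrow> real ^ 'm ^ 'n) \<Rightarrow>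
     (real ^ 'n) set \<Rightarrow> (real ^ 'n \<Rightarrow> real) \<Rightarrow> (real \<Rightarrow> real) \<Rightarrow> bool" where
  "strict_CBF f g C h \<alpha> \<longleftrightarrow>
     continuously_differentiable h \<and> extended_class_K_inf \<alpha> \<and>
     C = {x. h x \<ge> 0} \<and> frontier C = {x. h x = 0} \<and>
     (\<forall>x\<in>C. \<exists>u. gradient h x \<bullet> (f x + g x *v u) + \<alpha> (h x) > 0)"

text \<open>In the following, \<open>F\<close> is the nominal closed-loop vector field
  \<^term>\<open>closed_loop f g k\<close>.\<close>

definition is_filter_value ::
    "(real ^ 'n \<Rightarrow> real ^ 'n) \<Rightarrow> (real ^ 'n \<Rightarrow> real ^ 'm ^ 'n) \<Rightarrow> (real ^ 'n \<Rightarrow> real ^ 'm ^ 'm) \<Rightarrow>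
     (real ^ 'n \<Rightarrow> real) \<Rightarrow> (real \<Rightarrow> real) \<Rightarrow> real ^ 'n \<Rightarrow> real ^ 'm \<Rightarrow> bool" where
  "is_filter_value F g G h \<alpha> x \<theta> \<longleftrightarrow>
     is_arg_min (\<lambda>\<theta>. \<theta> \<bullet> (G x *v \<theta>))
       (\<lambda>\<theta>. gradient h x \<bullet> (F x + g x *v \<theta>) + \<alpha> (h x) \<ge> 0) \<theta>"

definition safety_filter ::
    "(real ^ 'n \<Rightarrow> real ^ 'n) \<Rightarrow> (real ^ 'n \<Rightarrow> real ^ 'm ^ 'n) \<Rightarrow> (real ^ 'n \<Rightarrow> real ^ 'm ^ 'm) \<Rightarrow>
     (real ^ 'n \<Rightarrow> real) \<Rightarrow> (real \<Rightarrow> real) \<Rightarrow> real ^ 'n \<Rightarrow> real ^ 'm" where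
  "safety_filter F g G h \<alpha> x = (THE \<theta>. is_filter_value F g G h \<alpha> x \<theta>)"

definition filtered_field ::
    "(real ^ 'n \<Rightarrow> real ^ 'n) \<Rightarrow> (real ^ 'n \<Rightarrow> real ^ 'm ^ 'n) \<Rightarrow> (real ^ 'n \<Rightarrow> real ^ 'm ^ 'm) \<Rightarrow>
     (real ^ 'n \<Rightarrow> real) \<Rightarrow> (real \<Rightarrow> real) \<Rightarrow> real ^ 'n \<Rightarrow> real ^ 'n" where
  "filtered_field F g G h \<alpha> x = F x + g x *v safety_filter F g G h \<alpha> x"

text \<open>The filtered system lives where the safety filter is well defined. Elsewhere the value of
  \<^const>\<open>safety_filter\<close> is arbitrary, so such points are not counted as equilibria.\<close>

definition filtered_equilibria ::
    "(real ^ 'n \<Rightarrow> real ^ 'n) \<Rightarrow> (real ^ 'n \<Rightarrow> real ^ 'm ^ 'n) \<Rightarrow> (real ^ 'n \<Rightarrow> real ^ 'm ^ 'm) \<Rightarrow>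
     (real ^ 'n \<Rightarrow> real) \<Rightarrow> (real \<Rightarrow> real) \<Rightarrow> (real ^ 'n) set" where
  "filtered_equilibria F g G h \<alpha> =
     {x. (\<exists>!\<theta>. is_filter_value F g G h \<alpha> x \<theta>) \<and> filtered_field F g G h \<alpha> x = 0}"

definition undesired_equilibria ::
    "(real ^ 'n \<Rightarrow> real ^ 'n) \<Rightarrow> (real ^ 'n \<Rightarrow> real ^ 'm ^ 'n) \<Rightarrow> (real ^ 'n \<Rightarrow> real ^ 'm ^ 'm) \<Rightarrow>
     (real ^ 'n \<Rightarrow> real) \<Rightarrow> (real ^ 'n) set" where
  "undesired_equilibria F g G h =
     {x. h x = 0 \<and>
         (\<exists>\<delta><0. F x = \<delta> *\<^sub>R (g x *v (matrix_inv (G x) *v (transpose (g x) *v gradient h x))))}"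

end

theory Submission
  imports Defs
begin

text \<open>The KKT conditions of the safety filter show that its equilibria are exactly the undesired ones
  together with the origin. A hyperbolic Jacobian is injective, and a zero of a vector field
  at which the derivative is injective is isolated. The set of undesired equilibria is closed and
  contained in \<open>frontier C\<close>, so for bounded \<open>frontier C\<close> it is compact, and a compact set is
  discrete iff it is finite.\<close>

section \<open>Positive definite matrices and continuity of matrix operations\<close>

text \<open>Symmetry of \<open>A\<close> merges the two cross terms. With \<open>y\<close> as
  candidate minimizer, optimality controls the linear term and definiteness the last one.\<close>

lemma positive_definite_quadratic_expansion:
  assumes "positive_definite A"
  shows "x \<bullet> (A *v x) = y \<bullet> (A *v y) + 2 * ((A *v y) \<bullet> (x - y)) + (x - y) \<bullet> (A *v (x - y))"
proof -
  have "x \<bullet> (A *v y) = y \<bullet> (A *v x)" for x y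
    using assms unfolding positive_definite_def
    by (metis dot_lmul_matrix transpose_matrix_vector inner_commute)
  then show ?thesis
    by (simp add: matrix_vector_mult_diff_distrib inner_diff_left inner_diff_right inner_commute)
qed

lemma positive_definite_invertible:
  assumes "positive_definite A"
  shows "invertible A"
  using assms unfolding invertible_left_inverse matrix_left_invertible_ker positive_definite_def
  by (metis inner_zero_right less_irrefl)

lemma matrix_vector_mult_matrix_inv:
  fixes A :: "real ^ 'n ^ 'n"
  assumes "invertible A"
  shows "A *v (matrix_inv A *v b) = b"
proof -
  have "A ** matrix_inv A = mat 1"
    using assms unfolding invertible_def matrix_inv_def by (rule someI2_ex) simp
  then show ?thesis
    by (simp add: matrix_vector_mul_assoc)
qed

lemma continuous_on_matrix_vector_mult [continuous_intros]:
  fixes A :: "'a::topological_space \<Rightarrow> real ^ 'n ^ 'm"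
  assumes "continuous_on S A" "continuous_on S b"
  shows "continuous_on S (\<lambda>x. A x *v b x)"
  unfolding matrix_vector_mult_def by (intro continuous_intros assms)

lemma continuous_on_transpose [continuous_intros]:
  fixes A :: "'a::topological_space \<Rightarrow> real ^ 'n ^ 'm"
  assumes "continuous_on S A"
  shows "continuous_on S (\<lambda>x. transpose (A x))"
  unfolding transpose_def by (intro continuous_intros assms)

lemma continuous_on_det:
  fixes A :: "'a::topological_space \<Rightarrow> real ^ 'n ^ 'n"
  assumes "continuous_on S A"
  shows "continuous_on S (\<lambda>x. det (A x))"
  unfolding det_def by (intro continuous_intros assms)

text \<open>Cramer's rule writes each component as a quotient of determinants, which are polynomial
  in the entries, with nonvanishing denominator.\<close>

lemma continuous_on_matrix_inv_vector_mult:
  fixes A :: "'a::topological_space \<Rightarrow> real ^ 'n ^ 'n"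
  assumes "continuous_on S A" "continuous_on S b" "\<And>x. x \<in> S \<Longrightarrow> invertible (A x)"
  shows "continuous_on S (\<lambda>x. matrix_inv (A x) *v b x)"
proof -
  have d: "det (A x) \<noteq> 0" if "x \<in> S" for x
    using assms(3)[OF that] by (simp add: invertible_det_nz)
  have "continuous_on S
      (\<lambda>x. \<chi> k. det (\<chi> i j. if j = k then b x $ i else A x $ i $ j) / det (A x))"
  proof (intro continuous_intros continuous_on_det)
    show "continuous_on S (\<lambda>x. if j = k then b x $ i else A x $ i $ j)" for i j k
      by (cases "j = k") (auto intro!: continuous_intros assms)
  qed (use assms(1) d in auto)
  moreover have "matrix_inv (A x) *v b x =
      (\<chi> k. det (\<chi> i j. if j = k then b x $ i else A x $ i $ j) / det (A x))" if "x \<in> S" for x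
    using matrix_vector_mult_matrix_inv[OF assms(3)[OF that], of "b x"]
    unfolding cramer[OF d[OF that]] .
  ultimately show ?thesis
    by (simp cong: continuous_on_cong)
qed

section \<open>Gradients, regularity and isolated zeros\<close>

text \<open>Replaces the definite description in \<open>gradient\<close> by an explicit sum, to
  which continuity rules apply once \<open>h'\<close> depends continuously on the point.\<close>

lemma gradient_eq_sum_Basis:
  fixes h :: "'a::euclidean_space \<Rightarrow> real"
  assumes "(h has_derivative h') (at x)"
  shows "gradient h x = (\<Sum>b\<in>Basis. h' b *\<^sub>R b)"
proof -
  let ?D = "\<Sum>b\<in>Basis. h' b *\<^sub>R b"
  have "linear h'"
    using assms by (rule has_derivative_linear)
  then have "h' v = v \<bullet> ?D" for v
    using Linear_Algebra.linear_componentwise[of h' v 1]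
    by (simp add: inner_sum_right mult.commute)
  then have eq: "h' = (\<lambda>v. v \<bullet> ?D)" ..
  show ?thesis
    unfolding gradient_def
  proof (rule the_equality)
    show "GDERIV h x :> ?D"
      using assms unfolding gderiv_def by (subst (asm) eq)
    fix D assume "GDERIV h x :> D"
    then have "h' = (\<lambda>v. v \<bullet> D)"
      using has_derivative_unique[OF assms] unfolding gderiv_def by blast
    then have "v \<bullet> D = v \<bullet> ?D" for v
      using eq by metis
    then show "D = ?D"
      using vector_eq_ldot[of D ?D] by blast
  qed
qed

lemma continuous_on_gradient:
  fixes h :: "'a::euclidean_space \<Rightarrow> real"
  assumes "continuously_differentiable h"
  shows "continuous_on UNIV (gradient h)"
proof -
  obtain h' :: "'a \<Rightarrow> 'a \<Rightarrow>\<^sub>L real"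
    where "\<And>x. (h has_derivative blinfun_apply (h' x)) (at x)" and "continuous_on UNIV h'"
    using assms unfolding continuously_differentiable_def by blast
  then have "gradient h = (\<lambda>x. \<Sum>b\<in>Basis. h' x b *\<^sub>R b)"
    and "continuous_on UNIV (\<lambda>x. \<Sum>b\<in>Basis. h' x b *\<^sub>R b)"
    by (auto simp: fun_eq_iff gradient_eq_sum_Basis intro!: blinfun.continuous_on
        continuous_on_sum continuous_on_scaleR continuous_on_const)
  then show ?thesis
    by simp
qed

lemma continuously_differentiable_imp_continuous_on:
  "continuously_differentiable F \<Longrightarrow> continuous_on S F"
proof (intro continuous_at_imp_continuous_on ballI)
  fix x
  assume "continuously_differentiable F"
  then obtain F' where "(F has_derivative blinfun_apply (F' x)) (at x)"
    unfolding continuously_differentiable_def by blast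
  then show "isCont F x"
    by (rule has_derivative_continuous)
qed

lemma locally_lipschitz_imp_continuous_on:
  "locally_lipschitz F \<Longrightarrow> continuous_on UNIV F"
  unfolding locally_lipschitz_def by (rule local_lipschitz_continuous_on[OF _ UNIV_I])

text \<open>An injective linear map on a finite-dimensional space is bounded below by
  \<open>B * norm v\<close> with \<open>B > 0\<close>. Near \<open>x\<close> the linearization error
  is at most half of that, so it cannot cancel the linear part.\<close>

lemma has_derivative_inj_eventually_neq:
  fixes \<Phi> :: "'a::real_normed_vector \<Rightarrow> 'b::euclidean_space"
  assumes der: "(\<Phi> has_derivative \<Phi>') (at x)" and "inj \<Phi>'"
  shows "\<forall>\<^sub>F y in at x. \<Phi> y \<noteq> \<Phi> x"
proof -
  obtain B where B: "B > 0" "\<And>v. B * norm v \<le> norm (\<Phi>' v)"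
    using linear_inj_bounded_below_pos[OF has_derivative_linear[OF der] \<open>inj \<Phi>'\<close>] by blast
  obtain d where d: "d > 0"
    "\<And>y. norm (y - x) < d \<Longrightarrow> norm (\<Phi> y - \<Phi> x - \<Phi>' (y - x)) \<le> B / 2 * norm (y - x)"
    using der B(1) unfolding has_derivative_at_alt by (meson half_gt_zero)
  have "\<Phi> y \<noteq> \<Phi> x" if "y \<noteq> x" "dist y x < d" for y
  proof
    assume "\<Phi> y = \<Phi> x"
    then have "norm (\<Phi>' (y - x)) \<le> B / 2 * norm (y - x)"
      using d(2)[of y] that by (simp add: dist_norm)
    with B(2)[of "y - x"] have "B * norm (y - x) \<le> B / 2 * norm (y - x)"
      by linarith
    with B(1) that show False
      by simp
  qed
  then show ?thesis
    using d(1) unfolding eventually_at by blast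
qed

section \<open>The safety filter, its equilibria, and closedness of the undesired ones\<close>

text \<open>Sufficiency of the KKT conditions with an active constraint. Towards a feasible \<eta>
  the linear term of the cost is nonnegative, and the quadratic term is positive unless \<eta>
  equals \<theta>; this gives minimality and uniqueness at once.\<close>

lemma filter_value_of_multiplier:
  assumes pd: "positive_definite (G x)"
    and stat: "G x *v \<theta> = \<mu> *\<^sub>R (transpose (g x) *v gradient h x)" and "\<mu> \<ge> 0"
    and active: "gradient h x \<bullet> (F x + g x *v \<theta>) + \<alpha> (h x) = 0"
  shows "is_filter_value F g G h \<alpha> x \<eta> \<longleftrightarrow> \<eta> = \<theta>"
proof -
  have le: "\<theta> \<bullet> (G x *v \<theta>) + (\<eta> - \<theta>) \<bullet> (G x *v (\<eta> - \<theta>)) \<le> \<eta> \<bullet> (G x *v \<eta>)"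
    if "gradient h x \<bullet> (F x + g x *v \<eta>) + \<alpha> (h x) \<ge> 0" for \<eta>
  proof -
    have "gradient h x \<bullet> (g x *v (\<eta> - \<theta>)) \<ge> 0"
      using that active by (simp add: matrix_vector_mult_diff_distrib inner_diff_right inner_add_right)
    then have "(G x *v \<theta>) \<bullet> (\<eta> - \<theta>) \<ge> 0"
      using \<open>\<mu> \<ge> 0\<close> by (simp add: stat dot_lmul_matrix)
    then show ?thesis
      using positive_definite_quadratic_expansion[OF pd, of \<eta> \<theta>] by simp
  qed
  have pos: "v \<bullet> (G x *v v) > 0" if "v \<noteq> 0" for v
    using pd that unfolding positive_definite_def by blast
  show ?thesis
  proof
    assume "is_filter_value F g G h \<alpha> x \<eta>"
    then have "gradient h x \<bullet> (F x + g x *v \<eta>) + \<alpha> (h x) \<ge> 0"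
      and "\<not> \<theta> \<bullet> (G x *v \<theta>) < \<eta> \<bullet> (G x *v \<eta>)"
      using active by (auto simp: is_filter_value_def is_arg_min_def)
    with le[of \<eta>] pos[of "\<eta> - \<theta>"] show "\<eta> = \<theta>"
      by fastforce
  next
    assume "\<eta> = \<theta>"
    moreover have "\<theta> \<bullet> (G x *v \<theta>) \<le> \<zeta> \<bullet> (G x *v \<zeta>)"
      if "gradient h x \<bullet> (F x + g x *v \<zeta>) + \<alpha> (h x) \<ge> 0" for \<zeta>
      using le[OF that] pos[of "\<zeta> - \<theta>"] by (cases "\<zeta> = \<theta>") auto
    ultimately show "is_filter_value F g G h \<alpha> x \<eta>"
      using active by (force simp: is_filter_value_def is_arg_min_def)
  qed
qed

text \<open>The KKT multiplier is \<open>- \<delta>\<close>: the corresponding input cancels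
  \<open>F x\<close>, and the constraint is active because \<open>\<alpha> (h x)\<close> vanishes on
  the boundary.\<close>

lemma undesired_equilibria_subset_filtered_equilibria:
  assumes pd: "\<And>x. positive_definite (G x)" and "\<alpha> 0 = 0"
  shows "undesired_equilibria F g G h \<subseteq> filtered_equilibria F g G h \<alpha>"
proof
  fix x assume "x \<in> undesired_equilibria F g G h"
  then obtain \<delta> where "h x = 0" "\<delta> < 0"
    and F: "F x = \<delta> *\<^sub>R (g x *v (matrix_inv (G x) *v (transpose (g x) *v gradient h x)))"
    unfolding undesired_equilibria_def by blast
  define \<theta> where "\<theta> = (- \<delta>) *\<^sub>R (matrix_inv (G x) *v (transpose (g x) *v gradient h x))"
  have 0: "F x + g x *v \<theta> = 0"
    unfolding F \<theta>_def matrix_vector_mult_scaleR by simp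
  have "G x *v \<theta> = (- \<delta>) *\<^sub>R (transpose (g x) *v gradient h x)"
    by (simp only: \<theta>_def matrix_vector_mult_scaleR
        matrix_vector_mult_matrix_inv[OF positive_definite_invertible[OF pd]])
  then have iff: "is_filter_value F g G h \<alpha> x \<eta> \<longleftrightarrow> \<eta> = \<theta>" for \<eta>
    using \<open>\<delta> < 0\<close> \<open>h x = 0\<close> \<open>\<alpha> 0 = 0\<close> 0
    by (intro filter_value_of_multiplier[where \<mu> = "- \<delta>"] pd) auto
  then have "safety_filter F g G h \<alpha> x = \<theta>"
    by (simp add: safety_filter_def)
  with 0 iff show "x \<in> filtered_equilibria F g G h \<alpha>"
    by (auto simp: filtered_equilibria_def filtered_field_def)
qed

text \<open>At an equilibrium the constraint reduces to \<open>\<alpha> (h x) \<ge> 0\<close>. Shrinking a nonzero filter value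
  lowers the cost and so must violate the constraint, which forces \<open>h x = 0\<close>; comparing the filter
  value with its \<open>G x\<close>-orthogonal projection to the line spanned by
  \<open>matrix_inv (G x) *v (transpose (g x) *v gradient h x)\<close> then shows that it lies on that line.\<close>

lemma filtered_equilibria_cases:
  assumes pd: "\<And>x. positive_definite (G x)" and \<alpha>: "extended_class_K_inf \<alpha>"
    and x: "x \<in> filtered_equilibria F g G h \<alpha>"
  shows "F x = 0 \<or> x \<in> undesired_equilibria F g G h"
proof (cases "F x = 0")
  case False
  define \<theta> where "\<theta> = safety_filter F g G h \<alpha> x"
  define b where "b = transpose (g x) *v gradient h x"
  define y where "y = matrix_inv (G x) *v b"
  have "is_filter_value F g G h \<alpha> x \<theta>"
    using x unfolding filtered_equilibria_def safety_filter_def \<theta>_def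
    by (blast intro: theI')
  moreover have 0: "F x + g x *v \<theta> = 0"
    using x unfolding filtered_equilibria_def filtered_field_def \<theta>_def by blast
  ultimately have feas: "\<alpha> (h x) \<ge> 0"
    and min: "\<And>\<eta>. gradient h x \<bullet> (F x + g x *v \<eta>) + \<alpha> (h x) \<ge> 0 \<Longrightarrow>
        \<theta> \<bullet> (G x *v \<theta>) \<le> \<eta> \<bullet> (G x *v \<eta>)"
    by (auto simp: is_filter_value_def is_arg_min_def not_less)
  have pos: "v \<bullet> (G x *v v) > 0" if "v \<noteq> 0" for v
    using pd that unfolding positive_definite_def by blast
  have "\<theta> \<noteq> 0"
    using 0 False by auto
  have g\<theta>: "g x *v \<theta> = - F x"
    using 0 by (simp add: eq_neg_iff_add_eq_0 add.commute)
  \<comment> \<open>The competitor is \<open>c *\<^sub>R \<theta>\<close>, whose cost is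
    \<open>c * c\<close> times that of \<theta>. Since \<open>g x *v \<theta>\<close> is
    \<open>- F x\<close>, the left side is its constraint value.\<close>
  have shrink: "(1 - c) * (gradient h x \<bullet> F x) + \<alpha> (h x) < 0" if "0 < c" "c < 1" for c
  proof -
    have "c * c < 1"
      using that by (metis mult_strict_mono' mult_1 less_eq_real_def)
    then have "(c *\<^sub>R \<theta>) \<bullet> (G x *v (c *\<^sub>R \<theta>)) < \<theta> \<bullet> (G x *v \<theta>)"
      using pos[OF \<open>\<theta> \<noteq> 0\<close>] by (simp add: matrix_vector_mult_scaleR flip: mult.assoc)
    then have "gradient h x \<bullet> (F x + g x *v (c *\<^sub>R \<theta>)) + \<alpha> (h x) < 0"
      using min[of "c *\<^sub>R \<theta>"] by linarith
    then show ?thesis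
      by (simp add: matrix_vector_mult_scaleR g\<theta> inner_add_right algebra_simps)
  qed
  have neg: "gradient h x \<bullet> F x < 0"
    using shrink[of "1/2"] feas by simp
  have "\<alpha> (h x) \<le> 0"
  proof (rule ccontr)
    assume "\<not> \<alpha> (h x) \<le> 0"
    \<comment> \<open>Chosen so that scaling \<theta> by \<open>1 - c\<close> leaves the constraint
      value \<open>c * \<alpha> (h x)\<close>, still positive, which contradicts
      \<open>shrink\<close>.\<close>
    define c where "c = \<alpha> (h x) / (\<alpha> (h x) - gradient h x \<bullet> F x)"
    have "0 < 1 - c" "1 - c < 1"
      using neg \<open>\<not> \<alpha> (h x) \<le> 0\<close> by (auto simp: c_def field_simps)
    then have "c * (gradient h x \<bullet> F x) + \<alpha> (h x) < 0"
      using shrink[of "1 - c"] by simp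
    moreover have "c * (gradient h x \<bullet> F x) + \<alpha> (h x) = c * \<alpha> (h x)"
      using neg \<open>\<not> \<alpha> (h x) \<le> 0\<close> by (simp add: c_def field_simps)
    ultimately show False
      using \<open>1 - c < 1\<close> \<open>\<not> \<alpha> (h x) \<le> 0\<close> by (smt (verit) mult_pos_pos)
  qed
  with feas \<alpha> have "h x = 0"
    unfolding extended_class_K_inf_def by (metis order_antisym strict_mono_eq)
  have Gy: "G x *v y = b"
    unfolding y_def by (rule matrix_vector_mult_matrix_inv[OF positive_definite_invertible[OF pd]])
  have b\<theta>: "b \<bullet> \<theta> = - (gradient h x \<bullet> F x)"
    by (simp add: b_def dot_lmul_matrix g\<theta>)
  then have "y \<noteq> 0"
    using neg Gy by auto
  then have q: "b \<bullet> y > 0"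
    using pos[of y] Gy by (simp add: inner_commute)
  \<comment> \<open>With this \<open>r\<close>, \<open>r *\<^sub>R y\<close> has the same inner
    product with \<open>b\<close> as \<theta>, hence the same constraint value, and is a feasible
    competitor.\<close>
  define r where "r = (b \<bullet> \<theta>) / (b \<bullet> y)"
  have "gradient h x \<bullet> (g x *v (r *\<^sub>R y)) = b \<bullet> (r *\<^sub>R y)"
    by (simp only: b_def transpose_matrix_vector dot_lmul_matrix)
  also have "\<dots> = - (gradient h x \<bullet> F x)"
    using q b\<theta> by (simp add: r_def)
  finally have "\<theta> \<bullet> (G x *v \<theta>) \<le> (r *\<^sub>R y) \<bullet> (G x *v (r *\<^sub>R y))"
    using feas by (intro min) (simp add: inner_add_right)
  \<comment> \<open>The \<open>G x\<close>-orthogonality removes the linear term of the quadratic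
    expansion, so minimality of \<theta> bounds the remaining definite term by zero.\<close>
  moreover have "(G x *v (r *\<^sub>R y)) \<bullet> (\<theta> - r *\<^sub>R y) = 0"
    using q by (simp add: matrix_vector_mult_scaleR Gy inner_diff_right r_def)
  ultimately have "(\<theta> - r *\<^sub>R y) \<bullet> (G x *v (\<theta> - r *\<^sub>R y)) \<le> 0"
    using positive_definite_quadratic_expansion[OF pd, of \<theta> x "r *\<^sub>R y"] by simp
  then have "\<theta> = r *\<^sub>R y"
    using pos[of "\<theta> - r *\<^sub>R y"] by fastforce
  then have "F x = (- r) *\<^sub>R (g x *v y)"
    using g\<theta> by (simp add: matrix_vector_mult_scaleR)
  moreover have "- r < 0"
    using q b\<theta> neg by (simp add: r_def divide_neg_pos)
  ultimately show ?thesis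
    using \<open>h x = 0\<close> unfolding undesired_equilibria_def y_def b_def by blast
qed simp

text \<open>Taking the inner product of the equilibrium equation with the gradient determines the
  multiplier \<open>\<delta>\<close>; clearing its denominator turns the defining condition into a closed one. The
  strict CBF condition keeps that denominator away from zero.\<close>

lemma undesired_equilibria_eq:
  fixes g :: "real ^ 'n \<Rightarrow> real ^ 'm ^ 'n" and h :: "real ^ 'n \<Rightarrow> real"
    and G :: "real ^ 'n \<Rightarrow> real ^ 'm ^ 'm"
  defines "b \<equiv> \<lambda>x. transpose (g x) *v gradient h x"
  defines "y \<equiv> \<lambda>x. matrix_inv (G x) *v b x"
  assumes pd: "\<And>x. positive_definite (G x)"
    and cbf: "\<forall>x. h x = 0 \<longrightarrow> (\<exists>u. gradient h x \<bullet> (F x + g x *v u) > 0)"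
    and F0: "\<forall>x. h x = 0 \<longrightarrow> F x \<noteq> 0"
  shows "undesired_equilibria F g G h =
    {x. h x = 0 \<and> gradient h x \<bullet> F x \<le> 0 \<and>
        (b x \<bullet> y x) *\<^sub>R F x = (gradient h x \<bullet> F x) *\<^sub>R (g x *v y x)}" (is "_ = ?R")
proof -
  have Gy: "G x *v y x = b x" for x
    unfolding y_def by (rule matrix_vector_mult_matrix_inv[OF positive_definite_invertible[OF pd]])
  have pos: "b x \<bullet> y x > 0" if "b x \<noteq> 0" for x
  proof -
    have "y x \<noteq> 0"
      using Gy[of x] that by auto
    then have "y x \<bullet> (G x *v y x) > 0"
      using pd[of x] unfolding positive_definite_def by blast
    then show ?thesis
      by (simp add: Gy inner_commute)
  qed
  have b: "b x \<bullet> v = gradient h x \<bullet> (g x *v v)" for x v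
    by (simp add: b_def dot_lmul_matrix)
  have U: "undesired_equilibria F g G h = {x. h x = 0 \<and> (\<exists>\<delta><0. F x = \<delta> *\<^sub>R (g x *v y x))}"
    by (simp add: undesired_equilibria_def y_def b_def)
  show ?thesis
  proof (intro subset_antisym subsetI)
    fix x assume "x \<in> undesired_equilibria F g G h"
    then obtain \<delta> where "h x = 0" "\<delta> < 0" and F: "F x = \<delta> *\<^sub>R (g x *v y x)"
      unfolding U by blast
    then have gF: "gradient h x \<bullet> F x = \<delta> * (b x \<bullet> y x)"
      by (simp add: b)
    moreover have "b x \<bullet> y x \<ge> 0"
      using pos[of x] by (cases "b x = 0") auto
    ultimately show "x \<in> ?R"
      using \<open>h x = 0\<close> \<open>\<delta> < 0\<close> F by (simp add: mult_nonpos_nonneg mult.commute)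
  next
    fix x assume "x \<in> ?R"
    then have "h x = 0" and le: "gradient h x \<bullet> F x \<le> 0"
      and eq: "(b x \<bullet> y x) *\<^sub>R F x = (gradient h x \<bullet> F x) *\<^sub>R (g x *v y x)"
      by auto
    obtain u where "gradient h x \<bullet> (F x + g x *v u) > 0"
      using cbf \<open>h x = 0\<close> by blast
    \<comment> \<open>If \<open>b x\<close> vanished, no input could change the derivative of
      \<open>h\<close>, and the sign in \<open>le\<close> would contradict the choice of
      \<open>u\<close>.\<close>
    then have "b x \<noteq> 0"
      using le b[of x u] by (auto simp: inner_add_right)
    then have q: "b x \<bullet> y x > 0"
      by (rule pos)
    have F: "F x = ((gradient h x \<bullet> F x) / (b x \<bullet> y x)) *\<^sub>R (g x *v y x)"
    proof -
      have "F x = (1 / (b x \<bullet> y x)) *\<^sub>R ((b x \<bullet> y x) *\<^sub>R F x)"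
        using q by simp
      then show ?thesis
        unfolding eq by simp
    qed
    \<comment> \<open>The closed condition would also admit the multiplier zero; it is excluded
      because \<open>F\<close> has no zero on the boundary.\<close>
    then have "gradient h x \<bullet> F x \<noteq> 0"
      using F0 \<open>h x = 0\<close> by auto
    then have "(gradient h x \<bullet> F x) / (b x \<bullet> y x) < 0"
      using le q by (simp add: divide_neg_pos)
    then show "x \<in> undesired_equilibria F g G h"
      using F \<open>h x = 0\<close> unfolding U by blast
  qed
qed

text \<open>The existential over negative \<delta> is not visibly a closed condition; the rewritten
  form consists of equations and a nonstrict inequality between continuous functions.\<close>

lemma closed_undesired_equilibria:
  assumes F: "continuous_on UNIV F" and g: "continuous_on UNIV g" and G: "continuous_on UNIV G"
    and h: "continuously_differentiable h"
    and pd: "\<And>x. positive_definite (G x)"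
    and "\<forall>x. h x = 0 \<longrightarrow> (\<exists>u. gradient h x \<bullet> (F x + g x *v u) > 0)"
    and "\<forall>x. h x = 0 \<longrightarrow> F x \<noteq> 0"
  shows "closed (undesired_equilibria F g G h)"
proof -
  note dh = continuous_on_gradient[OF h]
  have b: "continuous_on UNIV (\<lambda>x. transpose (g x) *v gradient h x)"
    by (intro continuous_on_matrix_vector_mult continuous_on_transpose g dh)
  have y: "continuous_on UNIV (\<lambda>x. matrix_inv (G x) *v (transpose (g x) *v gradient h x))"
    using G b positive_definite_invertible[OF pd] by (rule continuous_on_matrix_inv_vector_mult)
  show ?thesis
    unfolding undesired_equilibria_eq[where F = F and g = g and G = G and h = h, OF assms(5-7)]
    by (intro closed_Collect_conj closed_Collect_eq closed_Collect_le continuous_on_const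
        continuous_on_inner continuous_on_scaleR continuous_on_matrix_vector_mult[OF g] F dh b y
        continuously_differentiable_imp_continuous_on[OF h])
qed

section \<open>Hyperbolicity and isolation\<close>

text \<open>A nonzero real kernel vector, read as a complex vector, would be an eigenvector for the
  eigenvalue 0, whose real part is zero.\<close>

lemma inj_matrix_vector_mult_of_eigenvalues:
  fixes A :: "real ^ 'n ^ 'n"
  assumes "\<And>z. complex_eigenvalue A z \<Longrightarrow> Re z \<noteq> 0"
  shows "inj ((*v) A)"
proof -
  have "v = 0" if "A *v v = 0" for v
  proof (rule ccontr)
    assume "v \<noteq> 0"
    let ?w = "\<chi> i. complex_of_real (v $ i)"
    have "?w \<noteq> 0"
      using \<open>v \<noteq> 0\<close> by (auto simp: vec_eq_iff)
    moreover have "map_matrix complex_of_real A *v ?w = 0 *s ?w"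
    proof -
      have "(map_matrix complex_of_real A *v ?w) $ i = complex_of_real ((A *v v) $ i)" for i
        by (simp add: matrix_vector_mult_def)
      then show ?thesis
        using that by (simp add: vec_eq_iff)
    qed
    ultimately show False
      using assms[of 0] unfolding complex_eigenvalue_def by auto
  qed
  then show ?thesis
    by (metis matrix_left_invertible_injective matrix_left_invertible_ker)
qed

theorem lemma4p8:
  fixes f :: "real ^ 'n \<Rightarrow> real ^ 'n"
    and g :: "real ^ 'n \<Rightarrow> real ^ 'm ^ 'n"
    and k :: "real ^ 'n \<Rightarrow> real ^ 'm"
    and G :: "real ^ 'n \<Rightarrow> real ^ 'm ^ 'm"
    and h :: "real ^ 'n \<Rightarrow> real"
    and \<alpha> :: "real \<Rightarrow> real"
    and C :: "(real ^ 'n) set"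
  assumes "locally_lipschitz f" and "locally_lipschitz g" and "locally_lipschitz k"
    and "\<forall>x. closed_loop f g k x = 0 \<longleftrightarrow> x = 0"
    and "globally_asymptotically_stable_origin (closed_loop f g k)"
    and "continuously_differentiable G" and "\<forall>x. positive_definite (G x)"
    and "strict_CBF f g C h \<alpha>"
    and "h 0 > 0"
  shows "(\<forall>x \<in> undesired_equilibria (closed_loop f g k) g G h.
            filtered_field (closed_loop f g k) g G h \<alpha> differentiable (at x) \<and>
            (\<forall>z. complex_eigenvalue
                   (jacobian (filtered_field (closed_loop f g k) g G h \<alpha>) (at x)) z
                 \<longrightarrow> Re z \<noteq> 0)
            \<longrightarrow> x isolated_in filtered_equilibria (closed_loop f g k) g G h \<alpha>)
       \<and> (bounded (frontier C) \<longrightarrow>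
            ((\<forall>x \<in> undesired_equilibria (closed_loop f g k) g G h.
                x isolated_in filtered_equilibria (closed_loop f g k) g G h \<alpha>)
             \<longleftrightarrow> finite (undesired_equilibria (closed_loop f g k) g G h)))"
proof -
  let ?F = "closed_loop f g k"
  let ?U = "undesired_equilibria ?F g G h"
  let ?E = "filtered_equilibria ?F g G h \<alpha>"
  let ?\<Phi> = "filtered_field ?F g G h \<alpha>"
  have pd: "positive_definite (G x)" for x
    using assms(7) by blast
  have h: "continuously_differentiable h" and \<alpha>: "extended_class_K_inf \<alpha>"
    and C: "C = {x. h x \<ge> 0}" and fr: "frontier C = {x. h x = 0}"
    using assms(8) unfolding strict_CBF_def by auto
  have \<alpha>0: "\<alpha> 0 = 0"
    using \<alpha> unfolding extended_class_K_inf_def by blast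
  have UE: "?U \<subseteq> ?E"
    by (intro undesired_equilibria_subset_filtered_equilibria pd \<alpha>0)
  \<comment> \<open>The origin enters as the only zero of the nominal closed loop.\<close>
  have EU: "?E \<subseteq> insert 0 ?U"
    using filtered_equilibria_cases[where G = G, OF pd \<alpha>] assms(4) by blast
  have F0: "\<forall>x. h x = 0 \<longrightarrow> ?F x \<noteq> 0"
    using assms(4,9) by (metis less_irrefl)
  have cbf: "\<forall>x. h x = 0 \<longrightarrow> (\<exists>u. gradient h x \<bullet> (?F x + g x *v u) > 0)"
  proof (intro allI impI)
    fix x
    assume "h x = 0"
    then have "x \<in> C"
      by (simp add: C)
    then obtain u where "gradient h x \<bullet> (f x + g x *v u) + \<alpha> (h x) > 0"
      using assms(8) unfolding strict_CBF_def by blast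
    \<comment> \<open>Shifting the input by \<open>k x\<close> transfers the CBF condition from
      \<open>f\<close> to the nominal closed loop.\<close>
    then have "gradient h x \<bullet> (?F x + g x *v (u - k x)) > 0"
      by (simp add: \<open>h x = 0\<close> \<alpha>0 closed_loop_def matrix_vector_mult_diff_distrib)
    then show "\<exists>u. gradient h x \<bullet> (?F x + g x *v u) > 0" ..
  qed
  have cont: "continuous_on UNIV ?F"
    unfolding closed_loop_def
    by (intro continuous_intros locally_lipschitz_imp_continuous_on assms(1-3))
  have "closed ?U"
    by (intro closed_undesired_equilibria cont h pd cbf F0 locally_lipschitz_imp_continuous_on
        continuously_differentiable_imp_continuous_on assms(2,6))
  have 1: "x isolated_in ?E"
    if "x \<in> ?U" and diff: "?\<Phi> differentiable (at x)"
      and ev: "\<And>z. complex_eigenvalue (jacobian ?\<Phi> (at x)) z \<Longrightarrow> Re z \<noteq> 0" for x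
  proof -
    have "x \<in> ?E"
      using that(1) UE by blast
    moreover have "\<forall>\<^sub>F y in at x. ?\<Phi> y \<noteq> ?\<Phi> x"
      using diff inj_matrix_vector_mult_of_eigenvalues[OF ev] unfolding jacobian_works
      by (rule has_derivative_inj_eventually_neq)
    \<comment> \<open>Both \<open>x\<close> and any \<open>y\<close> in \<open>?E\<close> are zeros
      of \<open>?\<Phi>\<close>, so a nearby equilibrium would violate the inequality.\<close>
    then have "\<forall>\<^sub>F y in at x. y \<notin> ?E"
      by eventually_elim (use \<open>x \<in> ?E\<close> in \<open>simp add: filtered_equilibria_def\<close>)
    ultimately show ?thesis
      by (simp add: isolated_in_altdef)
  qed
  have 2: "(\<forall>x\<in>?U. x isolated_in ?E) \<longleftrightarrow> finite ?U" if "bounded (frontier C)"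
  proof
    assume iso: "\<forall>x\<in>?U. x isolated_in ?E"
    have "discrete ?U"
      using iso UE unfolding discrete_def isolated_in_islimpt_iff by (meson islimpt_subset)
    moreover have "compact ?U"
      unfolding compact_eq_bounded_closed
      using \<open>closed ?U\<close> that fr by (auto intro: bounded_subset simp: undesired_equilibria_def)
    ultimately show "finite ?U"
      using discrete_compact_finite_iff by blast
  next
    assume "finite ?U"
    \<comment> \<open>Isolation is meant among all filtered equilibria, so the possible extra point,
      the origin, has to be included before finiteness is used.\<close>
    then have "finite ?E"
      using EU by (meson finite_insert finite_subset)
    then show "\<forall>x\<in>?U. x isolated_in ?E"
      using UE by (auto simp: isolated_in_islimpt_iff islimpt_finite)
  qed
  show ?thesis
    using 1 2 by blast
qed

end
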